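(* Let $m$ be a positive integer, let $n\in\{2m,2m+1\}$, and let $F(x)=x^{2^{m+1}-1}$ be the power mapping on $\mathbb{F}_{2^n}$. (i) If $n=2m$, then $$|\{(a,b)\in\mathbb{F}_{2^n}^2:\mathrm{FBCT}_F(a,b)=2^n\}|=3\times 2^n-2,$$ $$|\{(a,b)\in\mathbb{F}_{2^n}^2:\mathrm{FBCT}_F(a,b)=2^m\}|=(2^m-2)(2^n-1),$$ $$|\{(a,b)\in\mathbb{F}_{2^n}^2:\mathrm{FBCT}_F(a,b)=0\}|=(2^n-2^m)(2^n-1).$$ (ii) If $n=2m+1$, then $$|\{(a,b)\in\mathbb{F}_{2^n}^2:\mathrm{FBCT}_F(a,b)=2^n\}|=3\times 2^n-2,$$ $$|\{(a,b)\in\mathbb{F}_{2^n}^2:\mathrm{FBCT}_F(a,b)=0\}|=(2^n-2)(2^n-1).$$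
   Context: $\mathbb{F}_{2^n}$ is the finite field with $2^n$ elements. For a mapping $F:\mathbb{F}_{2^n}\to\mathbb{F}_{2^n}$ and $(a,b)\in\mathbb{F}_{2^n}^2$, the Feistel Boomerang Connectivity Table (FBCT) entry is $$\mathrm{FBCT}_F(a,b)=|\{x\in\mathbb{F}_{2^n}:F(x)+F(x+a)+F(x+b)+F(x+a+b)=0\}|.$$ *)

theory Defs
  imports Main "HOL-Library.Cardinality"
begin

(* Entry (a, b) of the Feistel Boomerang Connectivity Table; the field is taken as a whole type,
   with F_{2^n} being any such type of cardinality 2^n. *)
definition fbct :: "('a::{finite, field} \<Rightarrow> 'a) \<Rightarrow> 'a \<Rightarrow> 'a \<Rightarrow> nat" where
  "fbct F a b = card {x. F x + F (x + a) + F (x + b) + F (x + a + b) = 0}"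

end

theory Submission
  imports Defs "HOL-Computational_Algebra.Polynomial" "HOL-Number_Theory.Residues"
begin

text \<open>
  By homogeneity it suffices to consider \<open>a = 1\<close>, \<open>b = t\<close> with \<open>t \<notin> {0, 1}\<close>. Let \<open>q = 2\<^sup>m\<^sup>+\<^sup>1\<close>. Since
  \<open>x F(x) = x\<^sup>q\<close>, clearing denominators turns the FBCT equation off \<open>{0, 1, t, t + 1}\<close> into
  \<open>t(t + 1) x\<^sup>q + (t + t\<^sup>q) x\<^sup>2 + (t\<^sup>2 + t\<^sup>q) x = 0\<close>, while a point of that set is a solution iff
  \<open>t\<^sup>q = t\<^sup>2\<close>, i.e. iff \<open>t\<close> is fixed by the \<open>m\<close>-fold Frobenius map. If it is fixed, the solutions are
  exactly the fixed points, \<open>2\<^sup>m\<close> in number for \<open>n = 2m\<close> (for \<open>n = 2m + 1\<close> only 0 and 1 are fixed).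
  Otherwise, eliminating the Frobenius power of \<open>x\<close> between the equation and its own Frobenius
  power leaves a nonzero multiple of \<open>x(x + 1)(x + t)(x + t + 1)\<close>, so there are no solutions.
\<close>

section \<open>Finite fields and characteristic 2\<close>

lemma power_CARD_eq_self:
  fixes x :: "'a::{finite, field}"
  shows "x ^ CARD('a) = x"
proof (cases "x = 0")
  case False
  \<comment> \<open>Multiplication by \<open>x\<close> permutes the nonzero elements, so their
    product cancels.\<close>
  have "(\<Prod>y\<in>UNIV - {0}. x * y) = (\<Prod>y\<in>UNIV - {0::'a}. y)"
    by (rule prod.reindex_bij_witness[of _ "\<lambda>y. y / x" "\<lambda>y. x * y"]) (use False in auto)
  moreover have "(\<Prod>y\<in>UNIV - {0::'a}. y) \<noteq> 0"
    by simp
  ultimately have "x ^ (CARD('a) - 1) = 1"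
    by (simp add: prod.distrib card_Diff_singleton)
  then show ?thesis
    using power_minus_mult[of "CARD('a)" x] by simp
qed (simp add: power_0_left)

lemma CHAR_eq_2:
  assumes "CARD('a::{finite, field}) = 2 ^ n"
  shows "CHAR('a) = 2"
proof -
  have "prime CHAR('a)"
    by (rule prime_CHAR_semidom) (simp add: finite_imp_CHAR_pos)
  moreover have "CHAR('a) dvd 2 ^ n"
    using CHAR_dvd_CARD[where 'a = 'a] assms by simp
  ultimately show ?thesis
    using prime_dvd_power_nat primes_dvd_imp_eq two_is_prime_nat by blast
qed

lemma add_power_two_power:
  fixes x y :: "'a::comm_semiring_1"
  assumes "CHAR('a) = 2"
  shows "(x + y) ^ (2 ^ k) = x ^ (2 ^ k) + y ^ (2 ^ k)"
  by (rule freshmans_dream') (simp_all add: assms)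

lemma add_eq_0_iff_CHAR_2:
  fixes x y :: "'a::ring_1"
  assumes "CHAR('a) = 2"
  shows "x + y = 0 \<longleftrightarrow> x = y"
  unfolding minus_CHAR_2[OF assms, of x y, symmetric] by simp

text \<open>After \<open>algebra_simps\<close> has sorted a sum, equal monomials are neighbours;
  these two rules delete such pairs, which is how polynomial identities modulo 2 are proved
  below.\<close>

lemma add_self_CHAR_2:
  fixes x y :: "'a::ring_1"
  assumes "CHAR('a) = 2"
  shows "x + x = 0" "x + (x + y) = y"
  by (simp_all add: add_eq_0_iff_CHAR_2[OF assms] flip: add.assoc)

lemma square_inject_CHAR_2:
  fixes x y :: "'a::idom"
  assumes "CHAR('a) = 2"
  shows "x\<^sup>2 = y\<^sup>2 \<longleftrightarrow> x = y"
  by (simp only: power2_eq_iff uminus_CHAR_2[OF assms] disj_absorb)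

section \<open>Homogeneity: reduction to \<open>a = 1\<close>\<close>

lemma fbct_scale:
  fixes F :: "'a::{finite, field} \<Rightarrow> 'a"
  assumes "F = (\<lambda>x. x ^ k)" "a \<noteq> 0"
  shows "fbct F a (a * t) = fbct F 1 t"
proof -
  have "F (a * x) + F (a * x + a) + F (a * x + a * t) + F (a * x + a + a * t)
      = a ^ k * (F x + F (x + 1) + F (x + t) + F (x + 1 + t))" for x
  proof -
    have "F (a * y) = a ^ k * F y" for y
      by (simp add: assms power_mult_distrib)
    from this[of x] this[of "x + 1"] this[of "x + t"] this[of "x + 1 + t"]
    show ?thesis by (simp add: distrib_left)
  qed
  then have scale: "F (a * x) + F (a * x + a) + F (a * x + a * t) + F (a * x + a + a * t) = 0
      \<longleftrightarrow> F x + F (x + 1) + F (x + t) + F (x + 1 + t) = 0" for x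
    using assms(2) by simp
  have "bij_betw (\<lambda>x. a * x) {x. F x + F (x + 1) + F (x + t) + F (x + 1 + t) = 0}
    {x. F x + F (x + a) + F (x + a * t) + F (x + a + a * t) = 0}"
  proof (rule bij_betwI[where g = "\<lambda>x. x / a"])
    show "(\<lambda>x. x / a) \<in> {x. F x + F (x + a) + F (x + a * t) + F (x + a + a * t) = 0}
      \<rightarrow> {x. F x + F (x + 1) + F (x + t) + F (x + 1 + t) = 0}"
      using scale[of "x / a" for x] assms(2) by simp
  qed (use assms(2) scale in simp_all)
  then show ?thesis
    unfolding fbct_def by (simp add: bij_betw_same_card)
qed

lemma fbct_trivial:
  fixes F :: "'a::{finite, field} \<Rightarrow> 'a"
  assumes "CHAR('a) = 2" "a = 0 \<or> b = 0 \<or> a = b"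
  shows "fbct F a b = CARD('a)"
proof -
  have "F x + F (x + a) + F (x + b) + F (x + a + b) = 0" for x
    using assms(2) by (auto simp: add_self_CHAR_2[OF assms(1)] add_ac)
  then show ?thesis
    by (simp add: fbct_def)
qed

text \<open>The row \<open>a = 0\<close> is constantly \<open>CARD('a)\<close>. Every other pair is
  uniquely \<open>(a, a * t)\<close>, with an entry depending on \<open>t\<close> only, so each
  \<open>t\<close> is counted \<open>CARD('a) - 1\<close> times.\<close>

lemma card_fbct_power:
  fixes F :: "'a::{finite, field} \<Rightarrow> 'a"
  assumes "CHAR('a) = 2" "F = (\<lambda>x. x ^ k)"
  shows "card {(a, b). fbct F a b = v}
    = (if v = CARD('a) then CARD('a) else 0) + (CARD('a) - 1) * card {t. fbct F 1 t = v}"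
proof -
  let ?Z = "{(a, b). a = 0 \<and> fbct F a b = v}"
  let ?N = "{(a, b). a \<noteq> 0 \<and> fbct F a b = v}"
  have "?Z = (if v = CARD('a) then {0} \<times> UNIV else {})"
    by (auto simp: fbct_trivial[OF assms(1)])
  then have Z: "card ?Z = (if v = CARD('a) then CARD('a) else 0)"
    by (simp add: card_cartesian_product)
  have "bij_betw (\<lambda>(a, t). (a, a * t)) ((UNIV - {0}) \<times> {t. fbct F 1 t = v}) ?N"
    by (intro bij_betw_byWitness[where f' = "\<lambda>(a, b). (a, b / a)"])
      (auto simp: fbct_scale[OF assms(2)] simp flip: fbct_scale[OF assms(2)])
  then have N: "card ?N = (CARD('a) - 1) * card {t. fbct F 1 t = v}"
    by (simp add: bij_betw_same_card[symmetric] card_cartesian_product card_Diff_singleton)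
  have "{(a, b). fbct F a b = v} = ?Z \<union> ?N"
    by auto
  moreover have "card (?Z \<union> ?N) = card ?Z + card ?N"
    by (rule card_Un_disjoint) auto
  ultimately show ?thesis
    using Z N by simp
qed

section \<open>The cleared equation and elimination\<close>

lemma second_derivative_times_denominator:
  fixes F :: "'a::field \<Rightarrow> 'a"
  assumes "CHAR('a) = 2" "F = (\<lambda>x. x ^ (2 ^ k - 1))"
  shows "x * (x + 1) * (x + t) * (x + 1 + t) * (F x + F (x + 1) + F (x + t) + F (x + 1 + t))
    = t * (t + 1) * x ^ (2 ^ k) + (t + t ^ (2 ^ k)) * x\<^sup>2 + (t\<^sup>2 + t ^ (2 ^ k)) * x"
proof -
  have F: "y * F y = y ^ (2 ^ k)" for y
    using power_minus_mult[of "2 ^ k" y] by (simp add: assms(2) mult.commute)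
  \<comment> \<open>Stated for variables, so that each argument is paired with its own value of
    \<open>F\<close> before any sum is multiplied out.\<close>
  have expand: "a * b * c * d * (p + q + r + s)
      = a * p * (b * c * d) + b * q * (a * c * d) + c * r * (a * b * d) + d * s * (a * b * c)"
    for a b c d p q r s :: 'a
    by (simp add: algebra_simps)
  have "x * (x + 1) * (x + t) * (x + 1 + t) * (F x + F (x + 1) + F (x + t) + F (x + 1 + t))
    = x * F x * ((x + 1) * (x + t) * (x + 1 + t)) + (x + 1) * F (x + 1) * (x * (x + t) * (x + 1 + t))
      + (x + t) * F (x + t) * (x * (x + 1) * (x + 1 + t))
      + (x + 1 + t) * F (x + 1 + t) * (x * (x + 1) * (x + t))"
    by (rule expand)
  also have "\<dots> = x ^ (2 ^ k) * ((x + 1) * (x + t) * (x + 1 + t)) + (x ^ (2 ^ k) + 1) * (x * (x + t) * (x + 1 + t))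
      + (x ^ (2 ^ k) + t ^ (2 ^ k)) * (x * (x + 1) * (x + 1 + t))
      + (x ^ (2 ^ k) + 1 + t ^ (2 ^ k)) * (x * (x + 1) * (x + t))"
    by (simp only: F add_power_two_power[OF assms(1)] power_one)
  also have "\<dots> = t * (t + 1) * x ^ (2 ^ k) + (t + t ^ (2 ^ k)) * x\<^sup>2 + (t\<^sup>2 + t ^ (2 ^ k)) * x"
    by (simp add: power2_eq_square algebra_simps add_self_CHAR_2[OF assms(1)])
  finally show ?thesis .
qed

text \<open>
  Here \<open>s\<close> and \<open>y\<close> stand for the images of \<open>t\<close> and \<open>x\<close> under the Frobenius power \<open>z \<mapsto> z\<^sup>q\<close>
  with \<open>q = 2\<^sup>m\<^sup>+\<^sup>1\<close>, \<open>n = 2m + 1\<close>, so that \<open>y\<^sup>q = x\<^sup>2\<close>: the second equation is the \<open>q\<close>-th power of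
  the first, and \<open>y\<close> is eliminated from the two.
\<close>
lemma eliminate_odd:
  fixes s t x y :: "'a::field"
  assumes "CHAR('a) = 2"
    and "t * (t + 1) * y + (t + s) * x\<^sup>2 + (t\<^sup>2 + s) * x = 0"
    and "s * (s + 1) * x\<^sup>2 + (s + t\<^sup>2) * y\<^sup>2 + (s\<^sup>2 + t\<^sup>2) * y = 0"
    and "s \<noteq> t" "s \<noteq> t\<^sup>2"
  shows "x * (x + 1) * (x + t) * (x + 1 + t) = 0"
proof -
  \<comment> \<open>The first two summands on the right cancel the \<open>y\<^sup>2\<close> terms,
    the third the remaining term linear in \<open>y\<close>. What is left is a quartic in
    \<open>x\<close> with leading coefficient
    \<open>(s + t\<^sup>2) * (s + t)\<^sup>2\<close>.\<close>
  have "(s + t\<^sup>2) * (s + t)\<^sup>2 * (x * (x + 1) * (x + t) * (x + 1 + t))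
    = (t * (t + 1))\<^sup>2 * (s * (s + 1) * x\<^sup>2 + (s + t\<^sup>2) * y\<^sup>2 + (s\<^sup>2 + t\<^sup>2) * y)
      + (s + t\<^sup>2) * (t * (t + 1) * y + (t + s) * x\<^sup>2 + (t\<^sup>2 + s) * x)\<^sup>2
      + t * (t + 1) * (s\<^sup>2 + t\<^sup>2) * (t * (t + 1) * y + (t + s) * x\<^sup>2 + (t\<^sup>2 + s) * x)"
    by (simp add: power2_eq_square algebra_simps add_self_CHAR_2[OF assms(1)])
  also have "\<dots> = 0"
    by (simp add: assms(2,3))
  finally have "(s + t\<^sup>2) * (s + t)\<^sup>2 * (x * (x + 1) * (x + t) * (x + 1 + t)) = 0" .
  then show ?thesis
    using assms(4,5) by (simp add: add_eq_0_iff_CHAR_2[OF assms(1)])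
qed

text \<open>
  The same elimination for \<open>q = 2\<^sup>m\<close> and \<open>n = 2m\<close>, where \<open>y\<^sup>q = x\<close>.
\<close>
lemma eliminate_even:
  fixes s t x y :: "'a::field"
  assumes "CHAR('a) = 2"
    and "t * (t + 1) * y\<^sup>2 + (t + s\<^sup>2) * x\<^sup>2 + (t\<^sup>2 + s\<^sup>2) * x = 0"
    and "s * (s + 1) * x\<^sup>2 + (s + t\<^sup>2) * y\<^sup>2 + (s\<^sup>2 + t\<^sup>2) * y = 0"
    and "s \<noteq> t"
  shows "x * (x + 1) * (x + t) * (x + 1 + t) = 0"
proof -
  have ne: "s + t \<noteq> 0"
    using assms(4) by (simp only: add_eq_0_iff_CHAR_2[OF assms(1)] not_False_eq_True)
  \<comment> \<open>Cancelling \<open>y\<^sup>2\<close> between the two equations leaves the common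
    factor \<open>(s + t)\<^sup>2\<close>; dividing it out gives a relation linear in
    \<open>y\<close>.\<close>
  have "(s + t)\<^sup>2 * (t * (t + 1) * y + (s + t) * x\<^sup>2 + (s + t\<^sup>2) * x)
    = t * (t + 1) * (s * (s + 1) * x\<^sup>2 + (s + t\<^sup>2) * y\<^sup>2 + (s\<^sup>2 + t\<^sup>2) * y)
      + (s + t\<^sup>2) * (t * (t + 1) * y\<^sup>2 + (t + s\<^sup>2) * x\<^sup>2 + (t\<^sup>2 + s\<^sup>2) * x)"
    by (simp add: power2_eq_square algebra_simps add_self_CHAR_2[OF assms(1)])
  also have "\<dots> = 0"
    by (simp add: assms(2,3))
  finally have E: "t * (t + 1) * y + (s + t) * x\<^sup>2 + (s + t\<^sup>2) * x = 0"
    using ne by simp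
  \<comment> \<open>Squaring that relation turns \<open>y\<close> into \<open>y\<^sup>2\<close>,
    which the first equation then removes.\<close>
  have "(s + t)\<^sup>2 * (x * (x + 1) * (x + t) * (x + 1 + t))
    = (t * (t + 1) * y + (s + t) * x\<^sup>2 + (s + t\<^sup>2) * x)\<^sup>2
      + t * (t + 1) * (t * (t + 1) * y\<^sup>2 + (t + s\<^sup>2) * x\<^sup>2 + (t\<^sup>2 + s\<^sup>2) * x)"
    by (simp add: power2_eq_square algebra_simps add_self_CHAR_2[OF assms(1)])
  also have "\<dots> = 0"
    by (simp add: E assms(2))
  finally show ?thesis
    using ne by simp
qed

lemma denominator_eq_0_iff:
  fixes x t :: "'a::field"
  assumes "CHAR('a) = 2"
  shows "x * (x + 1) * (x + t) * (x + 1 + t) = 0 \<longleftrightarrow> x \<in> {0, 1, t, 1 + t}"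
  by (simp add: add_eq_0_iff_CHAR_2[OF assms] add.assoc)

section \<open>The entries at \<open>(1, t)\<close> and the fixed points of Frobenius powers\<close>

text \<open>For such \<open>x\<close> the four arguments are 0, 1, \<open>t\<close>,
  \<open>1 + t\<close> in some order, so the sum does not depend on \<open>x\<close>; multiplying it
  by \<open>t * (1 + t)\<close> makes it computable.\<close>

lemma second_derivative_at_trivial:
  fixes F :: "'a::field \<Rightarrow> 'a"
  assumes "CHAR('a) = 2" "F = (\<lambda>x. x ^ (2 ^ k - 1))" "k > 0" "t \<notin> {0, 1}" "x \<in> {0, 1, t, 1 + t}"
  shows "F x + F (x + 1) + F (x + t) + F (x + 1 + t) = 0 \<longleftrightarrow> t ^ (2 ^ k) = t\<^sup>2"
proof -
  \<comment> \<open>For \<open>k = 0\<close> the exponent would be 0 and \<open>F 0\<close> would be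
    1.\<close>
  have "(2::nat) ^ k > 1"
    using assms(3) by (rule one_less_power[rotated]) simp
  then have F0: "F 0 = 0" "F 1 = 1"
    by (simp_all add: assms(2))
  have F: "y * F y = y ^ (2 ^ k)" for y
    using power_minus_mult[of "2 ^ k" y] by (simp add: assms(2) mult.commute)
  have "F x + F (x + 1) + F (x + t) + F (x + 1 + t) = 1 + F t + F (1 + t)"
    using assms(5) by (auto simp: add_self_CHAR_2[OF assms(1)] add_ac F0)
  moreover have "t * (1 + t) * (1 + F t + F (1 + t)) = t ^ (2 ^ k) + t\<^sup>2"
  proof -
    have "t * (1 + t) * (1 + F t + F (1 + t))
      = t * (1 + t) + (1 + t) * (t * F t) + t * ((1 + t) * F (1 + t))"
      by (simp add: algebra_simps)
    also have "\<dots> = t * (1 + t) + (1 + t) * t ^ (2 ^ k) + t * (1 + t ^ (2 ^ k))"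
      by (simp only: F add_power_two_power[OF assms(1)] power_one)
    also have "\<dots> = t ^ (2 ^ k) + t\<^sup>2"
      by (simp add: power2_eq_square algebra_simps add_self_CHAR_2[OF assms(1)])
    finally show ?thesis .
  qed
  moreover have "t * (1 + t) \<noteq> 0"
    using assms(4) by (auto simp: add_eq_0_iff_CHAR_2[OF assms(1)])
  ultimately show ?thesis
    using add_eq_0_iff_CHAR_2[OF assms(1), of "t ^ (2 ^ k)" "t\<^sup>2"] by (metis mult_eq_0_iff)
qed

lemma power_two_power_Suc: "(x::'a::monoid_mult) ^ (2 ^ (m + 1)) = (x ^ (2 ^ m))\<^sup>2"
  by (simp add: mult.commute flip: power_mult)

lemma fbct_eq_card_fixed:
  fixes F :: "'a::{finite, field} \<Rightarrow> 'a"
  assumes "CHAR('a) = 2" "F = (\<lambda>x. x ^ (2 ^ (m + 1) - 1))"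
    and "t \<notin> {0, 1}" "t ^ (2 ^ m) = t"
  shows "fbct F 1 t = card {x::'a. x ^ (2 ^ m) = x}"
proof -
  have Q: "t ^ (2 ^ (m + 1)) = t\<^sup>2"
    using assms(4) by (simp only: power_two_power_Suc)
  have "F x + F (x + 1) + F (x + t) + F (x + 1 + t) = 0 \<longleftrightarrow> x ^ (2 ^ m) = x" for x
  proof (cases "x \<in> {0, 1, t, 1 + t}")
    case True
    have "x ^ (2 ^ m) = x"
      using True assms(4) by (auto simp: add_power_two_power[OF assms(1)] power_0_left)
    then show ?thesis
      using second_derivative_at_trivial[OF assms(1,2) _ assms(3) True] Q by simp
  next
    case False
    \<comment> \<open>Since \<open>t ^ (2 ^ (m + 1)) = t\<^sup>2\<close>, the linear term vanishes
      and the other two coefficients agree, leaving a multiple of the square of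
      \<open>x ^ (2 ^ m) + x\<close>.\<close>
    have "x * (x + 1) * (x + t) * (x + 1 + t) * (F x + F (x + 1) + F (x + t) + F (x + 1 + t))
      = t * (t + 1) * ((x ^ (2 ^ m))\<^sup>2 + x\<^sup>2)"
      unfolding second_derivative_times_denominator[OF assms(1,2)] Q
      unfolding power_two_power_Suc
      by (simp add: power2_eq_square algebra_simps add_self_CHAR_2[OF assms(1)])
    moreover have "t * (t + 1) \<noteq> 0"
      using assms(3) by (auto simp: add_eq_0_iff_CHAR_2[OF assms(1)])
    ultimately have "F x + F (x + 1) + F (x + t) + F (x + 1 + t) = 0 \<longleftrightarrow> (x ^ (2 ^ m))\<^sup>2 + x\<^sup>2 = 0"
      using False denominator_eq_0_iff[OF assms(1), of x t] by (metis mult_eq_0_iff)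
    then show ?thesis
      by (simp add: add_eq_0_iff_CHAR_2[OF assms(1)] square_inject_CHAR_2[OF assms(1)])
  qed
  then show ?thesis
    by (simp add: fbct_def)
qed

text \<open>The part common to both parities: elimination, supplied as the last hypothesis, confines
  solutions to the four exceptional points, and these fail because \<open>t ^ (2 ^ k)\<close>
  differs from \<open>t\<^sup>2\<close>.\<close>

lemma fbct_eq_0:
  fixes F :: "'a::{finite, field} \<Rightarrow> 'a"
  assumes "CHAR('a) = 2" "F = (\<lambda>x. x ^ (2 ^ k - 1))" "k > 0"
    and "t \<notin> {0, 1}" "t ^ (2 ^ k) \<noteq> t\<^sup>2"
    and "\<And>x. t * (t + 1) * x ^ (2 ^ k) + (t + t ^ (2 ^ k)) * x\<^sup>2 + (t\<^sup>2 + t ^ (2 ^ k)) * x = 0 \<Longrightarrow>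
      x * (x + 1) * (x + t) * (x + 1 + t) = 0"
  shows "fbct F 1 t = 0"
proof -
  have "F x + F (x + 1) + F (x + t) + F (x + 1 + t) \<noteq> 0" for x
  proof
    assume 0: "F x + F (x + 1) + F (x + t) + F (x + 1 + t) = 0"
    then have "x * (x + 1) * (x + t) * (x + 1 + t) = 0"
      using second_derivative_times_denominator[OF assms(1,2), of x t] assms(6) by simp
    then show False
      using second_derivative_at_trivial[OF assms(1-4)] assms(5) 0 denominator_eq_0_iff[OF assms(1)]
      by blast
  qed
  then show ?thesis
    by (simp add: fbct_def)
qed

lemma power_two_power_even:
  fixes x :: "'a::{finite, field}"
  assumes "CARD('a) = 2 ^ (2 * m)"
  shows "(x ^ (2 ^ m)) ^ (2 ^ m) = x"
proof -
  have "(x ^ (2 ^ m)) ^ (2 ^ m) = x ^ CARD('a)"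
    by (simp add: assms mult_2 power_add flip: power_mult)
  then show ?thesis
    by (simp only: power_CARD_eq_self)
qed

lemma power_two_power_odd:
  fixes x :: "'a::{finite, field}"
  assumes "CARD('a) = 2 ^ (2 * m + 1)"
  shows "(x ^ (2 ^ (m + 1))) ^ (2 ^ (m + 1)) = x\<^sup>2"
proof -
  have "(2::nat) ^ (m + 1) * 2 ^ (m + 1) = CARD('a) * 2"
    by (simp add: assms mult_2[of m] power_add)
  then have "(x ^ (2 ^ (m + 1))) ^ (2 ^ (m + 1)) = (x ^ CARD('a))\<^sup>2"
    by (simp only: power_mult[symmetric])
  then show ?thesis
    by (simp only: power_CARD_eq_self)
qed

lemma fbct_eq_0_even:
  fixes F :: "'a::{finite, field} \<Rightarrow> 'a"
  assumes "CARD('a) = 2 ^ (2 * m)" "F = (\<lambda>x. x ^ (2 ^ (m + 1) - 1))"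
    and "t \<notin> {0, 1}" "t ^ (2 ^ m) \<noteq> t"
  shows "fbct F 1 t = 0"
proof (rule fbct_eq_0[OF _ assms(2) _ assms(3)])
  show C: "CHAR('a) = 2"
    using assms(1) by (rule CHAR_eq_2)
  show "t ^ (2 ^ (m + 1)) \<noteq> t\<^sup>2"
    using assms(4) by (simp only: power_two_power_Suc square_inject_CHAR_2[OF C] not_False_eq_True)
  fix x :: 'a
  define s y where "s = t ^ (2 ^ m)" and "y = x ^ (2 ^ m)"
  assume "t * (t + 1) * x ^ (2 ^ (m + 1)) + (t + t ^ (2 ^ (m + 1))) * x\<^sup>2 + (t\<^sup>2 + t ^ (2 ^ (m + 1))) * x = 0"
  then have A: "t * (t + 1) * y\<^sup>2 + (t + s\<^sup>2) * x\<^sup>2 + (t\<^sup>2 + s\<^sup>2) * x = 0"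
    by (simp only: s_def y_def power_two_power_Suc)
  have sq: "(z\<^sup>2) ^ (2 ^ m) = (z ^ (2 ^ m))\<^sup>2" for z :: 'a
    by (simp add: mult.commute flip: power_mult)
  \<comment> \<open>The \<open>2 ^ m\<close>-th power is an involution exchanging \<open>t\<close>
    with \<open>s\<close> and \<open>x\<close> with \<open>y\<close>.\<close>
  from A have "(t * (t + 1) * y\<^sup>2 + (t + s\<^sup>2) * x\<^sup>2 + (t\<^sup>2 + s\<^sup>2) * x) ^ (2 ^ m) = 0"
    by simp
  then have "s * (s + 1) * x\<^sup>2 + (s + t\<^sup>2) * y\<^sup>2 + (s\<^sup>2 + t\<^sup>2) * y = 0"
    by (simp add: add_power_two_power[OF C] power_mult_distrib sq s_def y_def
        power_two_power_even[OF assms(1)])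
  with A show "x * (x + 1) * (x + t) * (x + 1 + t) = 0"
    using assms(4) by (intro eliminate_even[OF C]) (simp_all add: s_def)
qed simp

text \<open>Iterating either map twice and using \<open>t ^ CARD('a) = t\<close> yields
  \<open>t\<^sup>2 = t\<close>. This supplies both conditions \<open>s \<noteq> t\<close> and
  \<open>s \<noteq> t\<^sup>2\<close> of \<open>eliminate_odd\<close>.\<close>

lemma frobenius_fixed_odd:
  fixes t :: "'a::{finite, field}"
  assumes "CARD('a) = 2 ^ (2 * m + 1)" "t ^ (2 ^ m) = t \<or> t ^ (2 ^ (m + 1)) = t"
  shows "t \<in> {0, 1}"
proof -
  have "t\<^sup>2 = t"
    using assms(2)
  proof
    assume "t ^ (2 ^ (m + 1)) = t"
    then show ?thesis using power_two_power_odd[OF assms(1), of t] by metis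
  next
    assume t: "t ^ (2 ^ m) = t"
    have "(2::nat) ^ (2 * m + 1) = 2 ^ m * 2 ^ m * 2"
      by (simp add: mult_2 power_add)
    then have "t ^ (2 ^ (2 * m + 1)) = ((t ^ (2 ^ m)) ^ (2 ^ m))\<^sup>2"
      by (simp only: power_mult)
    then show ?thesis
      using t power_CARD_eq_self[of t] by (simp only: assms(1))
  qed
  then show ?thesis
    by (simp add: power2_eq_square)
qed

lemma fbct_eq_0_odd:
  fixes F :: "'a::{finite, field} \<Rightarrow> 'a"
  assumes "CARD('a) = 2 ^ (2 * m + 1)" "F = (\<lambda>x. x ^ (2 ^ (m + 1) - 1))" and "t \<notin> {0, 1}"
  shows "fbct F 1 t = 0"
proof (rule fbct_eq_0[OF _ assms(2) _ assms(3)])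
  show C: "CHAR('a) = 2"
    using assms(1) by (rule CHAR_eq_2)
  show ne: "t ^ (2 ^ (m + 1)) \<noteq> t\<^sup>2"
    using frobenius_fixed_odd[OF assms(1), of t] assms(3)
    by (auto simp only: power_two_power_Suc square_inject_CHAR_2[OF C])
  fix x :: 'a
  define s y where "s = t ^ (2 ^ (m + 1))" and "y = x ^ (2 ^ (m + 1))"
  assume "t * (t + 1) * x ^ (2 ^ (m + 1)) + (t + t ^ (2 ^ (m + 1))) * x\<^sup>2 + (t\<^sup>2 + t ^ (2 ^ (m + 1))) * x = 0"
  then have A: "t * (t + 1) * y + (t + s) * x\<^sup>2 + (t\<^sup>2 + s) * x = 0"
    by (simp only: s_def y_def)
  have sq: "(z\<^sup>2) ^ (2 ^ (m + 1)) = (z ^ (2 ^ (m + 1)))\<^sup>2" for z :: 'a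
    by (simp add: mult.commute flip: power_mult)
  from A have "(t * (t + 1) * y + (t + s) * x\<^sup>2 + (t\<^sup>2 + s) * x) ^ (2 ^ (m + 1)) = 0"
    by simp
  then have "s * (s + 1) * x\<^sup>2 + (s + t\<^sup>2) * y\<^sup>2 + (s\<^sup>2 + t\<^sup>2) * y = 0"
    by (simp only: add_power_two_power[OF C] power_mult_distrib sq s_def y_def
        power_two_power_odd[OF assms(1)] power_one)
  with A show "x * (x + 1) * (x + t) * (x + 1 + t) = 0"
    using ne frobenius_fixed_odd[OF assms(1), of t] assms(3)
    by (intro eliminate_odd[OF C]) (auto simp only: s_def)
qed simp

text \<open>
  The lower bound holds because \<open>t \<mapsto> t\<^sup>q + t\<close>, \<open>q = 2\<^sup>m\<close>, is additive with the fixed points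
  of \<open>t \<mapsto> t\<^sup>q\<close> as kernel, and its image consists of such fixed points.
\<close>
lemma card_fixed_even:
  assumes "CARD('a::{finite, field}) = 2 ^ (2 * m)" "m > 0"
  shows "card {x::'a. x ^ (2 ^ m) = x} = 2 ^ m"
proof (rule antisym)
  let ?K = "{x::'a. x ^ (2 ^ m) = x}"
  have C: "CHAR('a) = 2"
    using assms(1) by (rule CHAR_eq_2)
  have q: "(2::nat) ^ m > 1"
    using assms(2) by (rule one_less_power[rotated]) simp
  \<comment> \<open>The upper bound counts roots; \<open>m > 0\<close> keeps the two monomials from
    cancelling.\<close>
  let ?p = "Polynomial.monom 1 (2 ^ m) - Polynomial.monom 1 1 :: 'a poly"
  have "Polynomial.coeff ?p (2 ^ m) \<noteq> 0"
    using q by simp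
  then have "?p \<noteq> 0"
    by (metis coeff_0)
  moreover have "degree ?p \<le> 2 ^ m"
    using q by (intro degree_diff_le order.trans[OF degree_monom_le]) simp_all
  ultimately have "card {x. poly ?p x = 0} \<le> 2 ^ m"
    using card_poly_roots_bound order.trans by blast
  then show "card ?K \<le> 2 ^ m"
    by (simp add: poly_monom)
  let ?\<phi> = "\<lambda>t::'a. t ^ (2 ^ m) + t"
  have im: "range ?\<phi> \<subseteq> ?K"
    by (auto simp: add_power_two_power[OF C] power_two_power_even[OF assms(1)] add.commute)
  \<comment> \<open>By additivity, translation by \<open>u\<close> maps the fibre through
    \<open>u\<close> into the kernel.\<close>
  have fib: "card {t. ?\<phi> t = ?\<phi> u} \<le> card ?K" for u
  proof (rule card_inj_on_le[where f = "\<lambda>t. t + u"])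
    show "(\<lambda>t. t + u) ` {t. ?\<phi> t = ?\<phi> u} \<subseteq> ?K"
    proof safe
      fix t assume "?\<phi> t = ?\<phi> u"
      then have "?\<phi> t + ?\<phi> u = 0"
        by (simp only: add_eq_0_iff_CHAR_2[OF C])
      then have "?\<phi> (t + u) = 0"
        by (simp add: add_power_two_power[OF C] add_ac)
      then show "(t + u) ^ (2 ^ m) = t + u"
        by (simp only: add_eq_0_iff_CHAR_2[OF C])
    qed
  qed (auto intro: inj_onI)
  have "CARD('a) = card (\<Union>v\<in>range ?\<phi>. {t. ?\<phi> t = v})"
    by (rule arg_cong[of _ _ card]) auto
  also have "\<dots> \<le> (\<Sum>v\<in>range ?\<phi>. card {t. ?\<phi> t = v})"
    by (rule card_UN_le) simp
  also have "\<dots> \<le> (\<Sum>v\<in>range ?\<phi>. card ?K)"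
    using fib by (intro sum_mono) auto
  also have "\<dots> \<le> card ?K * card ?K"
    using im by (simp add: card_mono)
  finally have "(2 ^ m)\<^sup>2 \<le> (card ?K)\<^sup>2"
    by (simp add: assms(1) power2_eq_square mult_2 power_add)
  then show "2 ^ m \<le> card ?K"
    by (rule power2_le_imp_le) simp
qed

section \<open>Counting the pairs\<close>

text \<open>The row \<open>a = 0\<close> contributes \<open>2 ^ n\<close> and the two values
  \<open>t = 0\<close>, \<open>t = 1\<close> contribute \<open>2 * (2 ^ n - 1)\<close>.\<close>

lemma card_fbct_full:
  fixes F :: "'a::{finite, field} \<Rightarrow> 'a"
  assumes "CHAR('a) = 2" "CARD('a) = 2 ^ n" "n > 0" "F = (\<lambda>x. x ^ k)"
    and "\<And>t. t \<notin> {0, 1} \<Longrightarrow> fbct F 1 t \<noteq> 2 ^ n"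
  shows "card {(a, b). fbct F a b = 2 ^ n} = 3 * 2 ^ n - 2"
proof -
  have "fbct F 1 t = 2 ^ n" if "t \<in> {0, 1}" for t
    using that fbct_trivial[OF assms(1), of 1 t F] assms(2) by auto
  then have "{t. fbct F 1 t = 2 ^ n} = {0, 1}"
    using assms(5) by blast
  moreover have "(2::nat) ^ n \<ge> 2"
    using power_increasing[of 1 n "2::nat"] assms(3) by simp
  ultimately show ?thesis
    by (simp add: card_fbct_power[OF assms(1,4)] assms(2))
qed

lemma card_fbct_odd:
  fixes F :: "'a::{finite, field} \<Rightarrow> 'a"
  assumes "CARD('a) = 2 ^ n" "n = 2 * m + 1" "F = (\<lambda>x. x ^ (2 ^ (m + 1) - 1))"
  shows "card {(a, b). fbct F a b = 2 ^ n} = 3 * 2 ^ n - 2"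
    and "card {(a, b). fbct F a b = 0} = (2 ^ n - 2) * (2 ^ n - 1)"
proof -
  have C: "CHAR('a) = 2"
    using assms(1) by (rule CHAR_eq_2)
  have triv: "fbct F 1 t = 2 ^ n" if "t \<in> {0, 1}" for t
    using that fbct_trivial[OF C, of 1 t F] assms(1) by auto
  have 0: "fbct F 1 t = 0" if "t \<notin> {0, 1}" for t
    using fbct_eq_0_odd[OF assms(1)[unfolded assms(2)] assms(3) that] .
  then show "card {(a, b). fbct F a b = 2 ^ n} = 3 * 2 ^ n - 2"
    using assms(2) by (intro card_fbct_full[OF C assms(1) _ assms(3)]) simp_all
  have "{t. fbct F 1 t = 0} = - {0, 1}"
    using 0 triv by force
  then have "card {t. fbct F 1 t = 0} = 2 ^ n - 2"
    using assms(1) by (simp add: Compl_eq_Diff_UNIV card_Diff_subset)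
  then show "card {(a, b). fbct F a b = 0} = (2 ^ n - 2) * (2 ^ n - 1)"
    by (simp add: card_fbct_power[OF C assms(3)] assms(1) mult.commute)
qed

lemma card_fbct_even:
  fixes F :: "'a::{finite, field} \<Rightarrow> 'a"
  assumes "CARD('a) = 2 ^ n" "n = 2 * m" "m > 0" "F = (\<lambda>x. x ^ (2 ^ (m + 1) - 1))"
  shows "card {(a, b). fbct F a b = 2 ^ n} = 3 * 2 ^ n - 2"
    and "card {(a, b). fbct F a b = 2 ^ m} = (2 ^ m - 2) * (2 ^ n - 1)"
    and "card {(a, b). fbct F a b = 0} = (2 ^ n - 2 ^ m) * (2 ^ n - 1)"
proof -
  have C: "CHAR('a) = 2"
    using assms(1) by (rule CHAR_eq_2)
  have triv: "fbct F 1 t = 2 ^ n" if "t \<in> {0, 1}" for t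
    using that fbct_trivial[OF C, of 1 t F] assms(1) by auto
  let ?K = "{x::'a. x ^ (2 ^ m) = x}"
  have card: "CARD('a) = 2 ^ (2 * m)"
    using assms(1,2) by simp
  have K: "card ?K = 2 ^ m" and K01: "{0, 1} \<subseteq> ?K"
    using card_fixed_even[OF card assms(3)] by (auto simp: power_0_left)
  have in_K: "fbct F 1 t = 2 ^ m" if "t \<in> ?K - {0, 1}" for t
    using fbct_eq_card_fixed[OF C assms(4), of t] K that by simp
  have notin_K: "fbct F 1 t = 0" if "t \<notin> ?K" for t
    by (rule fbct_eq_0_even[OF card assms(4)]) (use K01 that in auto)
  have ne: "(2::nat) ^ m \<noteq> 2 ^ n"
    using assms(2,3) by simp
  have "fbct F 1 t \<noteq> 2 ^ n" if "t \<notin> {0, 1}" for t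
    using in_K[of t] notin_K[of t] that ne by (cases "t \<in> ?K") auto
  then show "card {(a, b). fbct F a b = 2 ^ n} = 3 * 2 ^ n - 2"
    using assms(2,3) by (intro card_fbct_full[OF C assms(1) _ assms(4)]) simp_all
  \<comment> \<open>For \<open>m = 1\<close> this set is empty, in agreement with the factor
    \<open>2 ^ m - 2\<close>.\<close>
  have "{t. fbct F 1 t = 2 ^ m} = ?K - {0, 1}"
  proof (rule Set.set_eqI)
    fix t show "t \<in> {t. fbct F 1 t = 2 ^ m} \<longleftrightarrow> t \<in> ?K - {0, 1}"
      using in_K[of t] notin_K[of t] triv[of t] ne by (cases "t \<in> {0, 1}"; cases "t \<in> ?K") auto
  qed
  then have "card {t. fbct F 1 t = 2 ^ m} = 2 ^ m - 2"
    using K K01 by (simp add: card_Diff_subset)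
  then show "card {(a, b). fbct F a b = 2 ^ m} = (2 ^ m - 2) * (2 ^ n - 1)"
    using ne by (simp add: card_fbct_power[OF C assms(4)] assms(1) mult.commute)
  have "{t. fbct F 1 t = 0} = - ?K"
  proof (rule Set.set_eqI)
    fix t show "t \<in> {t. fbct F 1 t = 0} \<longleftrightarrow> t \<in> - ?K"
      using in_K[of t] notin_K[of t] triv[of t] by (cases "t \<in> {0, 1}"; cases "t \<in> ?K") auto
  qed
  then have "card {t. fbct F 1 t = 0} = 2 ^ n - 2 ^ m"
    using K assms(1) by (simp add: Compl_eq_Diff_UNIV card_Diff_subset)
  then show "card {(a, b). fbct F a b = 0} = (2 ^ n - 2 ^ m) * (2 ^ n - 1)"
    by (simp add: card_fbct_power[OF C assms(4)] assms(1) mult.commute)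
qed

theorem proposition2:
  fixes m n :: nat and F :: "'a::{finite, field} \<Rightarrow> 'a"
  assumes "m > 0"
    and "n \<in> {2 * m, 2 * m + 1}"
    and "CARD('a) = 2 ^ n"
    and "F = (\<lambda>x. x ^ (2 ^ (m + 1) - 1))"
  shows "(n = 2 * m \<longrightarrow>
            card {(a, b). fbct F a b = 2 ^ n} = 3 * 2 ^ n - 2 \<and>
            card {(a, b). fbct F a b = 2 ^ m} = (2 ^ m - 2) * (2 ^ n - 1) \<and>
            card {(a, b). fbct F a b = 0} = (2 ^ n - 2 ^ m) * (2 ^ n - 1)) \<and>
         (n = 2 * m + 1 \<longrightarrow>
            card {(a, b). fbct F a b = 2 ^ n} = 3 * 2 ^ n - 2 \<and>
            card {(a, b). fbct F a b = 0} = (2 ^ n - 2) * (2 ^ n - 1))"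
  using card_fbct_even[OF assms(3) _ assms(1,4)] card_fbct_odd[OF assms(3) _ assms(4)] by blast

end
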